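(* Let $n\ge 2$ be an integer. Then $$\ker\mathcal{D}_{\mathcal{K}_1}=\mathbb{Q}[x_0,C_2,C_3,\ldots,C_n][x_0^{-1}]\cap\mathbb{Q}[x_0,x_1,\ldots,x_n],$$ where $\mathcal{D}_{\mathcal{K}_1}$ is the first Kravchuk derivation of $\mathbb{Q}[x_0,x_1,\ldots,x_n]$, $C_2,\ldots,C_n$ are its Cayley elements, and the intersection is taken inside $\mathbb{Q}[x_0,x_1,\ldots,x_n][x_0^{-1}]$.
   Context: A derivation of $\mathbb{Q}[x_0,\ldots,x_n]$ is a $\mathbb{Q}$-linear map $D$ satisfying the Leibniz rule; it is determined by the values $D(x_m)$. Its kernel is $\ker D=\{f\in\mathbb{Q}[x_0,\ldots,x_n]: D(f)=0\}$. The first Kravchuk derivation $\mathcal{D}_{\mathcal{K}_1}$ is the derivation of $\mathbb{Q}[x_0,\ldots,x_n]$ with $$\mathcal{D}_{\mathcal{K}_1}(x_0)=0,\qquad \mathcal{D}_{\mathcal{K}_1}(x_m)=\sum_{i=1}^{m}\frac{1-(-1)^i}{2i}\,x_{m-i}\quad(1\le m\le n).$$ It is triangular, hence locally nilpotent. For $0\le m\le n$ put $$\sigma(x_m)=\sum_{k=0}^{\infty}\mathcal{D}_{\mathcal{K}_1}^k(x_m)\frac{\lambda^k}{k!},\qquad \lambda=-\frac{x_1}{x_0}$$ (a finite sum, lying in $\mathbb{Q}[x_0,\ldots,x_n][x_0^{-1}]$). The Cayley elements are $$C_m:=m\,(m-2)!\,x_0^{m-1}\sigma(x_m)\in\mathbb{Q}[x_0,\ldots,x_n],\qquad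 2\le m\le n;$$ for example $C_2=2x_2x_0-x_1^2$ and $C_3=3x_3x_0^2-x_1x_0^2-3x_1x_0x_2+x_1^3$. *)

theory Defs
  imports "HOL-Library.Poly_Mapping" "HOL-Computational_Algebra.Polynomial_Factorial"
begin

text \<open>
  Rational polynomials in the variables \<open>x\<^sub>0, x\<^sub>1, \<dots>\<close> as the monoid algebra of the
  exponent vectors. The ring \<open>\<rat>[x\<^sub>0, \<dots>, x\<^sub>n]\<close> is the subset \<open>polys n\<close>. The ring
  \<open>\<rat>[x\<^sub>0, \<dots>, x\<^sub>n][x\<^sub>0\<^sup>-\<^sup>1]\<close> and its subrings are regarded as subsets of the fraction
  field, into which polynomials are embedded by \<^const>\<open>to_fract\<close>.
\<close>

type_synonym qpoly = "(nat \<Rightarrow>\<^sub>0 nat) \<Rightarrow>\<^sub>0 rat"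

definition qconst :: "rat \<Rightarrow> qpoly"
  where "qconst c = Poly_Mapping.single 0 c"

definition qvar :: "nat \<Rightarrow> qpoly"
  where "qvar i = Poly_Mapping.single (Poly_Mapping.single i 1) 1"

definition polys :: "nat \<Rightarrow> qpoly set"
  where "polys n = {f. \<forall>t \<in> Poly_Mapping.keys f. Poly_Mapping.keys t \<subseteq> {0..n}}"

text \<open>Only the restriction of \<open>D\<close> to \<open>polys n\<close> matters in the following notions.\<close>

definition derivation_on :: "nat \<Rightarrow> (qpoly \<Rightarrow> qpoly) \<Rightarrow> bool"
  where "derivation_on n D \<longleftrightarrow>
    (\<forall>f \<in> polys n. D f \<in> polys n) \<and>
    (\<forall>f \<in> polys n. \<forall>g \<in> polys n. D (f + g) = D f + D g) \<and>
    (\<forall>c. \<forall>f \<in> polys n. D (qconst c * f) = qconst c * D f) \<and>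
    (\<forall>f \<in> polys n. \<forall>g \<in> polys n. D (f * g) = D f * g + f * D g)"

definition kernel_on :: "nat \<Rightarrow> (qpoly \<Rightarrow> qpoly) \<Rightarrow> qpoly set"
  where "kernel_on n D = {f \<in> polys n. D f = 0}"

definition first_kravchuk_derivation :: "nat \<Rightarrow> (qpoly \<Rightarrow> qpoly) \<Rightarrow> bool"
  where "first_kravchuk_derivation n D \<longleftrightarrow>
    derivation_on n D \<and>
    D (qvar 0) = 0 \<and>
    (\<forall>m \<in> {1..n}. D (qvar m) =
      (\<Sum>i=1..m. qconst ((1 - (-1) ^ i) / (2 * of_nat i)) * qvar (m - i)))"

definition lam :: "qpoly fract"
  where "lam = - (to_fract (qvar 1) / to_fract (qvar 0))"

text \<open>
  \<^const>\<open>Sum_any\<close> sums over all \<open>k\<close> with nonzero summand. These are finitely many for the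
  first Kravchuk derivation and \<open>m \<le> n\<close>; see \<open>kravchuk_funpow_qvar_eq_0\<close> below.
\<close>

definition sigma :: "(qpoly \<Rightarrow> qpoly) \<Rightarrow> nat \<Rightarrow> qpoly fract"
  where "sigma D m =
    Sum_any (\<lambda>k. to_fract ((D ^^ k) (qvar m)) * (lam ^ k / of_nat (fact k)))"

definition cayley :: "(qpoly \<Rightarrow> qpoly) \<Rightarrow> nat \<Rightarrow> qpoly fract"
  where "cayley D m = of_nat (m * fact (m - 2)) * to_fract (qvar 0) ^ (m - 1) * sigma D m"

text \<open>\<open>adjoin R S\<close> is \<open>R[S]\<close>, the smallest subring containing \<open>R\<close> and \<open>S\<close>.\<close>

inductive_set adjoin :: "'a::comm_ring_1 set \<Rightarrow> 'a set \<Rightarrow> 'a set"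
  for R S :: "'a set"
  where
    base: "a \<in> R \<Longrightarrow> a \<in> adjoin R S"
  | gen: "a \<in> S \<Longrightarrow> a \<in> adjoin R S"
  | one: "1 \<in> adjoin R S"
  | diff: "a \<in> adjoin R S \<Longrightarrow> b \<in> adjoin R S \<Longrightarrow> a - b \<in> adjoin R S"
  | mult: "a \<in> adjoin R S \<Longrightarrow> b \<in> adjoin R S \<Longrightarrow> a * b \<in> adjoin R S"

definition rationals :: "qpoly fract set"
  where "rationals = range (\<lambda>c. to_fract (qconst c))"


text \<open>
  The remaining facts show that the first Kravchuk derivation exists and is unique on
  \<open>polys n\<close>, that the sum defining \<^const>\<open>sigma\<close> is finite, and what the first Cayley
  elements are.
\<close>

lemma poly_mapping_sum_single:
  "f = (\<Sum>t\<in>Poly_Mapping.keys f. Poly_Mapping.single t (Poly_Mapping.lookup f t))"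
proof (rule poly_mapping_eqI)
  fix k
  show "Poly_Mapping.lookup f k = Poly_Mapping.lookup
    (\<Sum>t\<in>Poly_Mapping.keys f. Poly_Mapping.single t (Poly_Mapping.lookup f t)) k"
    by (simp add: lookup_sum lookup_single when_def in_keys_iff)
qed

lemma qpoly_induct [case_names zero add]:
  fixes f :: "'a \<Rightarrow>\<^sub>0 'b::comm_monoid_add"
  assumes "P 0"
    and "\<And>t c g. t \<in> Poly_Mapping.keys f \<Longrightarrow> P g \<Longrightarrow> P (Poly_Mapping.single t c + g)"
  shows "P f"
proof -
  have "P (\<Sum>t\<in>A. Poly_Mapping.single t (Poly_Mapping.lookup f t))"
    if "finite A" "A \<subseteq> Poly_Mapping.keys f" for A
    using that by (induction A) (simp_all add: assms)
  from this[of "Poly_Mapping.keys f"] show ?thesis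
    using poly_mapping_sum_single[of f] by simp
qed

lemma polys_add: "f \<in> polys n \<Longrightarrow> g \<in> polys n \<Longrightarrow> f + g \<in> polys n"
  using keys_add[of f g] by (auto simp: polys_def)

lemma polys_0: "0 \<in> polys n"
  by (simp add: polys_def)

lemma polys_sum: "(\<And>i. i \<in> I \<Longrightarrow> f i \<in> polys n) \<Longrightarrow> sum f I \<in> polys n"
  by (induction I rule: infinite_finite_induct) (auto simp: polys_add polys_0)

lemma polys_mult:
  assumes "f \<in> polys n" "g \<in> polys n" shows "f * g \<in> polys n"
proof -
  have "Poly_Mapping.keys t \<subseteq> {0..n}" if t: "t \<in> Poly_Mapping.keys (f * g)" for t
  proof -
    obtain a b where "t = a + b" "a \<in> Poly_Mapping.keys f" "b \<in> Poly_Mapping.keys g"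
      using keys_mult[of f g] t by blast
    then show ?thesis
      using assms keys_add[of a b] unfolding polys_def by blast
  qed
  then show ?thesis by (simp add: polys_def)
qed

lemma polys_single: "Poly_Mapping.keys t \<subseteq> {0..n} \<Longrightarrow> Poly_Mapping.single t c \<in> polys n"
  by (simp add: polys_def)

lemma polys_qconst: "qconst c \<in> polys n"
  by (simp add: qconst_def polys_single)

lemma polys_qvar: "i \<le> n \<Longrightarrow> qvar i \<in> polys n"
  by (simp add: qvar_def polys_single)

text \<open>\<open>ext_der n v\<close> is the derivation sending \<open>x\<^sub>i\<close> to \<open>v i\<close> for \<open>i \<le> n\<close>.\<close>

definition mono_der :: "nat \<Rightarrow> (nat \<Rightarrow> qpoly) \<Rightarrow> (nat \<Rightarrow>\<^sub>0 nat) \<Rightarrow> qpoly"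
  where "mono_der n v t = (\<Sum>i\<le>n.
    Poly_Mapping.single (t - Poly_Mapping.single i 1) (of_nat (Poly_Mapping.lookup t i)) * v i)"

definition ext_der :: "nat \<Rightarrow> (nat \<Rightarrow> qpoly) \<Rightarrow> qpoly \<Rightarrow> qpoly"
  where "ext_der n v f =
    (\<Sum>t\<in>Poly_Mapping.keys f. qconst (Poly_Mapping.lookup f t) * mono_der n v t)"

lemma minus_single_add:
  "Poly_Mapping.lookup s i \<noteq> 0 \<Longrightarrow>
    s + t - Poly_Mapping.single i (1::nat) = (s - Poly_Mapping.single i 1) + t"
  by (rule poly_mapping_eqI) (auto simp: lookup_add lookup_minus lookup_single when_def)

lemma single_mult_minus_single:
  "Poly_Mapping.single (s + t - Poly_Mapping.single i (1::nat))
     (of_nat (Poly_Mapping.lookup s i) :: rat) =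
   Poly_Mapping.single (s - Poly_Mapping.single i 1) (of_nat (Poly_Mapping.lookup s i)) *
     Poly_Mapping.single t 1"
  by (cases "Poly_Mapping.lookup s i = 0") (simp_all add: mult_single minus_single_add[simplified])

lemma mono_der_add:
  "mono_der n v (s + t) =
    mono_der n v s * Poly_Mapping.single t 1 + Poly_Mapping.single s 1 * mono_der n v t"
proof -
  have "Poly_Mapping.single (s + t - Poly_Mapping.single i 1)
      (of_nat (Poly_Mapping.lookup (s + t) i)) * v i =
    Poly_Mapping.single (s - Poly_Mapping.single i 1) (of_nat (Poly_Mapping.lookup s i)) * v i *
      Poly_Mapping.single t 1 +
    Poly_Mapping.single s 1 *
      (Poly_Mapping.single (t - Poly_Mapping.single i 1) (of_nat (Poly_Mapping.lookup t i)) * v i)"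
    for i
    using single_mult_minus_single[of s t i] single_mult_minus_single[of t s i]
    by (simp add: lookup_add single_add algebra_simps add.commute[of t s])
  then show ?thesis
    by (simp add: mono_der_def sum.distrib sum_distrib_left sum_distrib_right)
qed

lemma qconst_0: "qconst 0 = 0" and qconst_add: "qconst (a + b) = qconst a + qconst b"
  and qconst_mult: "qconst (a * b) = qconst a * qconst b" and qconst_1: "qconst 1 = 1"
  by (simp_all add: qconst_def single_add mult_single)

lemma ext_der_superset:
  assumes "finite A" "Poly_Mapping.keys f \<subseteq> A"
  shows "ext_der n v f = (\<Sum>t\<in>A. qconst (Poly_Mapping.lookup f t) * mono_der n v t)"
  unfolding ext_der_def
  by (rule sum.mono_neutral_left) (use assms in \<open>auto simp: in_keys_iff qconst_0\<close>)

lemma ext_der_add: "ext_der n v (f + g) = ext_der n v f + ext_der n v g"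
proof -
  let ?A = "Poly_Mapping.keys f \<union> Poly_Mapping.keys g"
  show ?thesis
    using ext_der_superset[of ?A "f + g" n v] ext_der_superset[of ?A f n v]
      ext_der_superset[of ?A g n v] keys_add[of f g]
    by (simp add: lookup_add qconst_add distrib_right sum.distrib)
qed

lemma ext_der_single:
  "ext_der n v (Poly_Mapping.single t c) = qconst c * mono_der n v t"
  using ext_der_superset[of "{t}" "Poly_Mapping.single t c" n v] by simp

lemma ext_der_0: "ext_der n v 0 = 0"
  by (simp add: ext_der_def)

lemma ext_der_mult_single:
  "ext_der n v (Poly_Mapping.single s a * g) =
    ext_der n v (Poly_Mapping.single s a) * g + Poly_Mapping.single s a * ext_der n v g"
proof (induction g rule: qpoly_induct)
  case (add t c g)
  have split: "Poly_Mapping.single u b = qconst b * Poly_Mapping.single u 1"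
    for u :: "nat \<Rightarrow>\<^sub>0 nat" and b
    by (simp add: qconst_def mult_single)
  have "ext_der n v (Poly_Mapping.single s a * Poly_Mapping.single t c) =
      (qconst a * mono_der n v s) * (qconst c * Poly_Mapping.single t 1) +
      (qconst a * Poly_Mapping.single s 1) * (qconst c * mono_der n v t)"
    unfolding mult_single ext_der_single mono_der_add qconst_mult by (simp add: algebra_simps)
  then have "ext_der n v (Poly_Mapping.single s a * Poly_Mapping.single t c) =
      ext_der n v (Poly_Mapping.single s a) * Poly_Mapping.single t c +
      Poly_Mapping.single s a * ext_der n v (Poly_Mapping.single t c)"
    by (simp add: ext_der_single split[symmetric])
  then show ?case
    using add(2) by (simp add: distrib_left distrib_right ext_der_add add_ac)
qed (simp add: ext_der_0)

lemma ext_der_mult: "ext_der n v (f * g) = ext_der n v f * g + f * ext_der n v g"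
proof (induction f rule: qpoly_induct)
  case (add t c f)
  then show ?case
    by (simp add: distrib_right ext_der_add ext_der_mult_single add_ac)
qed (simp add: ext_der_0)

lemma ext_der_qvar: assumes "m \<le> n" shows "ext_der n v (qvar m) = v m"
proof -
  have "mono_der n v (Poly_Mapping.single m 1) =
      (\<Sum>i\<le>n. if i = m then v m else 0)"
    unfolding mono_der_def by (rule sum.cong) (auto simp: lookup_single when_def)
  then show ?thesis
    using assms by (simp add: qvar_def ext_der_single qconst_1)
qed

lemma keys_minus_subset: "Poly_Mapping.keys (s - t) \<subseteq> Poly_Mapping.keys (s :: 'a \<Rightarrow>\<^sub>0 nat)"
  by (auto simp: in_keys_iff lookup_minus)

lemma ext_der_polys:
  assumes "\<And>i. i \<le> n \<Longrightarrow> v i \<in> polys n" "f \<in> polys n"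
  shows "ext_der n v f \<in> polys n"
  unfolding ext_der_def mono_der_def
proof (intro polys_sum polys_mult polys_qconst polys_single assms)
  fix t i assume "t \<in> Poly_Mapping.keys f"
  then have "Poly_Mapping.keys t \<subseteq> {0..n}"
    using assms(2) by (simp add: polys_def)
  then show "Poly_Mapping.keys (t - Poly_Mapping.single i 1) \<subseteq> {0..n}"
    by (rule order.trans[OF keys_minus_subset])
qed simp

lemma ext_der_derivation:
  assumes "\<And>i. i \<le> n \<Longrightarrow> v i \<in> polys n"
  shows "derivation_on n (ext_der n v)"
proof -
  have "mono_der n v 0 = 0"
    by (simp add: mono_der_def)
  then have "ext_der n v (qconst c * f) = qconst c * ext_der n v f" for c f
    unfolding ext_der_mult by (simp add: qconst_def ext_der_single)
  then show ?thesis
    unfolding derivation_on_def by (intro conjI ballI allI ext_der_polys assms ext_der_add ext_der_mult)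
qed

lemma first_kravchuk_derivation_exists: "\<exists>D. first_kravchuk_derivation n D"
proof
  let ?v = "\<lambda>m. \<Sum>i=1..m. qconst ((1 - (-1) ^ i) / (2 * of_nat i)) * qvar (m - i)"
  have "?v i \<in> polys n" if "i \<le> n" for i
    by (intro polys_sum polys_mult polys_qconst polys_qvar) (use that in auto)
  then have "derivation_on n (ext_der n ?v)"
    by (rule ext_der_derivation)
  moreover have "ext_der n ?v (qvar 0) = 0"
    by (simp add: ext_der_qvar)
  moreover have "\<forall>m\<in>{1..n}. ext_der n ?v (qvar m) = ?v m"
    using ext_der_qvar[of _ n ?v] by simp
  ultimately show "first_kravchuk_derivation n (ext_der n ?v)"
    unfolding first_kravchuk_derivation_def by (intro conjI)
qed

lemma derivation_on_1: assumes "derivation_on n D" shows "D 1 = 0"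
proof -
  have "D (1 * 1) = D 1 * 1 + 1 * D 1"
    using assms polys_qconst[of 1 n] by (simp only: derivation_on_def qconst_1)
  then show ?thesis by simp
qed

lemma derivation_on_0: assumes "derivation_on n D" shows "D 0 = 0"
proof -
  have "D (0 + 0) = D 0 + D 0"
    using assms polys_0[of n] by (simp only: derivation_on_def)
  then show ?thesis by simp
qed

lemma derivation_on_unique:
  assumes D: "derivation_on n D" and E: "derivation_on n E"
    and eq: "\<And>i. i \<le> n \<Longrightarrow> D (qvar i) = E (qvar i)"
    and f: "f \<in> polys n"
  shows "D f = E f"
proof -
  have plus: "G (f + g) = G f + G g" and mult: "G (f * g) = G f * g + f * G g"
    and const: "G (qconst c * f) = qconst c * G f"
    if "derivation_on n G" "f \<in> polys n" "g \<in> polys n" for G f g c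
    using that by (simp_all add: derivation_on_def)
  have one: "D 1 = E 1" "1 \<in> polys n"
    using derivation_on_1[OF D] derivation_on_1[OF E] polys_qconst[of 1 n] by (simp_all add: qconst_1)
  have times: "D (f * g) = E (f * g)"
    if "D f = E f" "D g = E g" "f \<in> polys n" "g \<in> polys n" for f g
    using mult[OF D that(3,4)] mult[OF E that(3,4)] that(1,2) by simp
  have power: "qvar i ^ k \<in> polys n \<and> D (qvar i ^ k) = E (qvar i ^ k)" if "i \<le> n" for i k
    using one polys_qvar[OF that] eq[OF that] by (induction k) (simp_all add: polys_mult times)
  have monomial: "D (Poly_Mapping.single t 1) = E (Poly_Mapping.single t 1)"
    if t: "Poly_Mapping.keys t \<subseteq> {0..n}" for t
  proof -
    let ?m = "\<lambda>A. \<Prod>i\<in>A. qvar i ^ Poly_Mapping.lookup t i"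
    have "?m A \<in> polys n \<and> D (?m A) = E (?m A)" if "finite A" "A \<subseteq> {0..n}" for A
      using that one power by (induction A) (simp_all add: polys_mult times)
    then have "D (?m (Poly_Mapping.keys t)) = E (?m (Poly_Mapping.keys t))"
      using t by simp
    moreover have "qvar i ^ k = Poly_Mapping.single (Poly_Mapping.single i k) 1" for i k
      by (induction k) (simp_all add: qvar_def mult_single flip: single_add)
    moreover have "(\<Prod>i\<in>A. Poly_Mapping.single (g i) (1::rat)) =
        Poly_Mapping.single (\<Sum>i\<in>A. g i) 1" for A :: "nat set" and g :: "nat \<Rightarrow> nat \<Rightarrow>\<^sub>0 nat"
      by (induction A rule: infinite_finite_induct) (simp_all add: mult_single)
    ultimately show ?thesis
      using poly_mapping_sum_single[of t, symmetric] by simp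
  qed
  have "f \<in> polys n \<and> D f = E f" (is "?P f")
  proof (induction f rule: qpoly_induct)
    case zero
    then show ?case using D E by (simp add: polys_0 derivation_on_0)
  next
    case (add t c g)
    have t: "Poly_Mapping.keys t \<subseteq> {0..n}"
      using add(1) f by (simp add: polys_def)
    have m: "Poly_Mapping.single t 1 \<in> polys n"
      using t by (rule polys_single)
    have c: "Poly_Mapping.single t c = qconst c * Poly_Mapping.single t 1"
      by (simp add: qconst_def mult_single)
    have "D (qconst c * Poly_Mapping.single t 1) = E (qconst c * Poly_Mapping.single t 1)"
      by (simp only: const[OF D m m] const[OF E m m] monomial[OF t])
    then have "D (Poly_Mapping.single t c) = E (Poly_Mapping.single t c)"
      by (simp only: c[symmetric])
    moreover have "Poly_Mapping.single t c \<in> polys n"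
      using t by (rule polys_single)
    ultimately show ?case
      using add(2) D E by (simp add: plus polys_add)
  qed
  then show ?thesis by simp
qed

lemma first_kravchuk_derivation_unique:
  assumes "first_kravchuk_derivation n D" "first_kravchuk_derivation n E" "f \<in> polys n"
  shows "D f = E f"
proof (rule derivation_on_unique[of n D E f])
  fix i assume "i \<le> n"
  then show "D (qvar i) = E (qvar i)"
    using assms by (cases "i = 0") (auto simp: first_kravchuk_derivation_def)
qed (use assms in \<open>auto simp: first_kravchuk_derivation_def\<close>)

lemma derivation_on_funpow_sum:
  assumes D: "derivation_on n D" and f: "\<And>i. i \<in> I \<Longrightarrow> f i \<in> polys n"
  shows "(D ^^ k) (\<Sum>i\<in>I. qconst (c i) * f i) = (\<Sum>i\<in>I. qconst (c i) * (D ^^ k) (f i))"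
proof -
  have mem: "(D ^^ k) (f i) \<in> polys n" if "i \<in> I" for i k
    using D f[OF that] by (induction k) (simp_all add: derivation_on_def)
  have step: "D (\<Sum>i\<in>I. qconst (c i) * g i) = (\<Sum>i\<in>I. qconst (c i) * D (g i))"
    if "\<And>i. i \<in> I \<Longrightarrow> g i \<in> polys n" for g
    using that
  proof (induction I rule: infinite_finite_induct)
    case (insert j I)
    have "(\<Sum>i\<in>I. qconst (c i) * g i) \<in> polys n"
      using insert.prems by (intro polys_sum polys_mult polys_qconst) auto
    moreover have "qconst (c j) * g j \<in> polys n"
      using insert.prems by (intro polys_mult polys_qconst) auto
    ultimately show ?case
      using insert D by (simp add: derivation_on_def)
  qed (simp_all add: derivation_on_0[OF D])
  show ?thesis
    by (induction k) (simp_all add: step[OF mem])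
qed

lemma kravchuk_funpow_Suc:
  assumes D: "first_kravchuk_derivation n D" and m: "1 \<le> m" "m \<le> n"
  shows "(D ^^ Suc k) (qvar m) =
    (\<Sum>i=1..m. qconst ((1 - (-1) ^ i) / (2 * of_nat i)) * (D ^^ k) (qvar (m - i)))"
proof -
  have "D (qvar m) = (\<Sum>i=1..m. qconst ((1 - (-1) ^ i) / (2 * of_nat i)) * qvar (m - i))"
    using D m by (simp add: first_kravchuk_derivation_def)
  moreover have "derivation_on n D"
    using D by (simp add: first_kravchuk_derivation_def)
  then have "(D ^^ k) (\<Sum>i=1..m. qconst ((1 - (-1) ^ i) / (2 * of_nat i)) * qvar (m - i)) =
      (\<Sum>i=1..m. qconst ((1 - (-1) ^ i) / (2 * of_nat i)) * (D ^^ k) (qvar (m - i)))"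
    by (rule derivation_on_funpow_sum) (use m in \<open>auto intro: polys_qvar\<close>)
  ultimately show ?thesis
    by (simp only: funpow_Suc_right o_apply)
qed

lemma kravchuk_funpow_qvar_eq_0:
  assumes D: "first_kravchuk_derivation n D" and "m \<le> n" "m < k"
  shows "(D ^^ k) (qvar m) = 0"
  using assms(2,3)
proof (induction k arbitrary: m)
  case (Suc k)
  show ?case
  proof (cases "m = 0")
    case True
    have D0: "D (qvar 0) = 0" "D 0 = 0"
      using D derivation_on_0 by (auto simp: first_kravchuk_derivation_def)
    have "(D ^^ j) 0 = 0" for j
      by (induction j) (simp_all add: D0)
    then show ?thesis
      using True D0 by (simp only: funpow_Suc_right o_apply)
  next
    case False
    have "(D ^^ k) (qvar (m - i)) = 0" if "i \<in> {1..m}" for i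
      using that Suc False by (intro Suc.IH) auto
    then show ?thesis
      using False Suc.prems kravchuk_funpow_Suc[OF D, of m k] by simp
  qed
qed simp

lemma sigma_eq_sum:
  assumes "first_kravchuk_derivation n D" "m \<le> n"
  shows "sigma D m = (\<Sum>k\<le>m. to_fract ((D ^^ k) (qvar m)) * (lam ^ k / of_nat (fact k)))"
  unfolding sigma_def
proof (rule Sum_any.expand_superset)
  show "{k. to_fract ((D ^^ k) (qvar m)) * (lam ^ k / of_nat (fact k)) \<noteq> 0} \<subseteq> {..m}"
    using kravchuk_funpow_qvar_eq_0[OF assms] by (auto simp: not_less[symmetric])
qed simp

lemma to_fract_power: "to_fract (x ^ k) = to_fract x ^ k"
  by (induction k) simp_all

lemma to_fract_numeral: "to_fract (numeral w) = numeral w"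
proof -
  have "to_fract (of_nat k) = of_nat k" for k
    by (induction k) simp_all
  from this[of "numeral w"] show ?thesis by simp
qed

lemma qvar_neq_0: "qvar i \<noteq> 0"
proof
  assume "qvar i = 0"
  then have "Poly_Mapping.keys (qvar i) = {}" by simp
  then show False by (simp add: qvar_def)
qed

lemma qpoly_fract_numeral_neq_0: "(numeral w :: qpoly fract) \<noteq> 0"
  by (metis to_fract_numeral to_fract_eq_0_iff zero_neq_numeral)

lemma cayley_2:
  assumes D: "first_kravchuk_derivation n D" and n: "n \<ge> 2"
  shows "cayley D 2 = to_fract (2 * qvar 2 * qvar 0 - qvar 1 ^ 2)"
proof -
  have val: "D (qvar m) = (\<Sum>i=1..m. qconst ((1 - (-1) ^ i) / (2 * of_nat i)) * qvar (m - i))"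
    if "m \<in> {1..n}" for m
    using D that by (simp add: first_kravchuk_derivation_def)
  have D1: "D (qvar 1) = qvar 0" and D2: "D (qvar 2) = qvar 1"
    using val[of 1] val[of 2] n by (simp_all add: numeral_2_eq_2 qconst_0 qconst_1)
  have sigma: "sigma D 2 = to_fract (qvar 2) + to_fract (qvar 1) * lam + to_fract (qvar 0) * (lam ^ 2 / 2)"
    using sigma_eq_sum[OF D n] D1 D2 by (simp add: atMost_nat_numeral atMost_Suc numeral_2_eq_2)
  have calc: "2 * x0 * (x2 + x1 * - (x1 / x0) + x0 * ((- (x1 / x0)) ^ 2 / 2)) =
      2 * x2 * x0 - x1 ^ 2" if "x0 \<noteq> 0" for x0 x1 x2 :: "qpoly fract"
    using that by (simp add: qpoly_fract_numeral_neq_0 field_simps power2_eq_square)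
  have "to_fract (qvar 0) \<noteq> 0"
    by (simp add: qvar_neq_0)
  from calc[OF this] show ?thesis
    by (simp add: cayley_def sigma lam_def to_fract_power to_fract_numeral)
qed

lemma cayley_3:
  assumes D: "first_kravchuk_derivation n D" and n: "n \<ge> 3"
  shows "cayley D 3 = to_fract
    (3 * qvar 3 * qvar 0 ^ 2 - qvar 1 * qvar 0 ^ 2 - 3 * qvar 1 * qvar 0 * qvar 2 + qvar 1 ^ 3)"
proof -
  have val: "D (qvar m) = (\<Sum>i=1..m. qconst ((1 - (-1) ^ i) / (2 * of_nat i)) * qvar (m - i))"
    if "m \<in> {1..n}" for m
    using D that by (simp add: first_kravchuk_derivation_def)
  have D0: "D (qvar 0) = 0" and D1: "D (qvar 1) = qvar 0" and D2: "D (qvar 2) = qvar 1"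
    and D3: "D (qvar 3) = qvar 2 + qconst (1 / 3) * qvar 0"
    using D val[of 1] val[of 2] val[of 3] n
    by (simp_all add: first_kravchuk_derivation_def numeral_2_eq_2 numeral_3_eq_3 qconst_0 qconst_1)
  have "derivation_on n D"
    using D by (simp add: first_kravchuk_derivation_def)
  then have lin: "D (qconst c * f) = qconst c * D f" "D (f + g) = D f + D g"
    if "f \<in> polys n" "g \<in> polys n" for c f g
    using that by (simp_all add: derivation_on_def)
  have "D (qconst (1 / 3) * qvar 0) = 0"
    using lin(1)[OF polys_qvar polys_qvar, of 0 0 "1 / 3"] D0 by simp
  moreover have "D (qvar 2 + qconst (1 / 3) * qvar 0) =
      D (qvar 2) + D (qconst (1 / 3) * qvar 0)"
    by (rule lin) (use n in \<open>auto intro: polys_qvar polys_mult polys_qconst\<close>)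
  ultimately have D33: "D (qvar 2 + qconst (1 / 3) * qvar 0) = qvar 1"
    using D2 by simp
  have third: "to_fract (qconst (1 / 3)) = 1 / 3"
  proof -
    have "qconst (1 / 3) * 3 = qconst (1 / 3 + 1 / 3 + 1 / 3)"
      unfolding qconst_add by (simp add: algebra_simps)
    then have "to_fract (qconst (1 / 3) * 3) = 1"
      by (simp add: qconst_1)
    then show ?thesis
      using qpoly_fract_numeral_neq_0 by (simp add: to_fract_numeral field_simps)
  qed
  have fact3: "fact 3 = (6 :: nat)" "fact 2 = (2 :: nat)"
    by (simp_all add: eval_nat_numeral)
  have "{..3} = {0, 1, 2, 3 :: nat}"
    by auto
  then have "sigma D 3 =
      to_fract ((D ^^ 0) (qvar 3)) * (lam ^ 0 / of_nat (fact 0)) +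
      to_fract ((D ^^ 1) (qvar 3)) * (lam ^ 1 / of_nat (fact 1)) +
      to_fract ((D ^^ 2) (qvar 3)) * (lam ^ 2 / of_nat (fact 2)) +
      to_fract ((D ^^ 3) (qvar 3)) * (lam ^ 3 / of_nat (fact 3))"
    using sigma_eq_sum[OF D n] by simp
  moreover have "(D ^^ 2) (qvar 3) = qvar 1" "(D ^^ 3) (qvar 3) = qvar 0"
    using D1 D3 D33 by (simp_all add: eval_nat_numeral)
  ultimately have sigma: "sigma D 3 = to_fract (qvar 3) + (to_fract (qvar 2) + to_fract (qvar 0) / 3) * lam +
      to_fract (qvar 1) * (lam ^ 2 / 2) + to_fract (qvar 0) * (lam ^ 3 / 6)"
    using D3 fact3 by (simp add: third)
  have calc: "3 * x0 ^ 2 * (x3 + (x2 + x0 / 3) * - (x1 / x0) + x1 * ((- (x1 / x0)) ^ 2 / 2) +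
      x0 * ((- (x1 / x0)) ^ 3 / 6)) = 3 * x3 * x0 ^ 2 - x1 * x0 ^ 2 - 3 * x1 * x0 * x2 + x1 ^ 3"
    if "x0 \<noteq> 0" for x0 x1 x2 x3 :: "qpoly fract"
    using that
    by (simp add: qpoly_fract_numeral_neq_0 field_simps power2_eq_square power3_eq_cube)
  have "to_fract (qvar 0) \<noteq> 0"
    by (simp add: qvar_neq_0)
  from calc[OF this] show ?thesis
    by (simp add: cayley_def sigma lam_def to_fract_power to_fract_numeral)
qed

end

theory Submission
  imports Defs
begin

text \<open>
  A total extension of the derivation extends further to a derivation \<open>E\<close> of the fraction
  field. Since \<open>E \<lambda> = -1\<close>, the series \<open>\<sigma>(x\<^sub>m)\<close> telescopes under \<open>E\<close>, so the ring
  \<open>A = \<rat>[x\<^sub>0, C\<^sub>2, \<dots>, C\<^sub>n][x\<^sub>0\<^sup>-\<^sup>1]\<close> lies in the kernel of \<open>E\<close>; this is the inclusion from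
  right to left. Conversely, solving the definition of \<open>\<sigma>(x\<^sub>m)\<close> for \<open>x\<^sub>m\<close> shows
  inductively that every \<open>x\<^sub>m\<close> lies in \<open>A[\<lambda>]\<close>. As \<open>E \<lambda> = -1\<close>, the element \<open>\<lambda>\<close> is
  transcendental over the kernel of \<open>E\<close>, hence an element of \<open>A[\<lambda>]\<close> that is killed by \<open>E\<close>
  is a constant polynomial in \<open>\<lambda>\<close>, that is, an element of \<open>A\<close>.
\<close>

section \<open>Arithmetic in adjoined rings\<close>

lemma adjoin_0: "0 \<in> adjoin R S"
  using adjoin.diff[OF adjoin.one adjoin.one] by simp

lemma adjoin_uminus: "a \<in> adjoin R S \<Longrightarrow> - a \<in> adjoin R S"
  using adjoin.diff[OF adjoin_0] by fastforce

lemma adjoin_add: "a \<in> adjoin R S \<Longrightarrow> b \<in> adjoin R S \<Longrightarrow> a + b \<in> adjoin R S"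
  using adjoin.diff[OF _ adjoin_uminus] by fastforce

lemma adjoin_sum: "(\<And>i. i \<in> I \<Longrightarrow> f i \<in> adjoin R S) \<Longrightarrow> sum f I \<in> adjoin R S"
  by (induction I rule: infinite_finite_induct) (auto simp: adjoin_0 adjoin_add)

lemma adjoin_power: "a \<in> adjoin R S \<Longrightarrow> a ^ k \<in> adjoin R S"
  by (induction k) (auto simp: adjoin.one adjoin.mult)

text \<open>The values at \<open>t\<close> of polynomials over \<open>adjoin R S\<close> form a
  ring. The coefficients range over an \<open>adjoin\<close> because products of polynomials need a
  coefficient set closed under sums and products.\<close>

lemma adjoin_singleton_poly:
  assumes "x \<in> adjoin (adjoin R S) {t}"
  shows "\<exists>p. (\<forall>i. coeff p i \<in> adjoin R S) \<and> x = poly p t"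
  using assms
proof induction
  case (base a)
  then show ?case
    by (intro exI[of _ "[:a:]"]) (auto simp: coeff_pCons adjoin_0 split: nat.split)
next
  case (gen a)
  then show ?case
    by (intro exI[of _ "[:0, 1:]"]) (auto simp: coeff_pCons adjoin_0 adjoin.one split: nat.split)
next
  case one
  show ?case
    by (intro exI[of _ 1]) (auto simp: adjoin_0 adjoin.one)
next
  case (diff a b)
  then obtain p q where "\<forall>i. coeff p i \<in> adjoin R S" "a = poly p t"
    "\<forall>i. coeff q i \<in> adjoin R S" "b = poly q t" by blast
  then show ?case
    by (intro exI[of _ "p - q"]) (auto simp: adjoin.diff)
next
  case (mult a b)
  then obtain p q where "\<forall>i. coeff p i \<in> adjoin R S" "a = poly p t"
    "\<forall>i. coeff q i \<in> adjoin R S" "b = poly q t" by blast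
  then show ?case
    by (intro exI[of _ "p * q"]) (auto simp: coeff_mult intro!: adjoin_sum adjoin.mult)
qed

section \<open>Derivations and transcendence over their constants\<close>

locale ring_derivation =
  fixes d :: "'a::comm_ring_1 \<Rightarrow> 'a"
  assumes add: "d (x + y) = d x + d y"
    and mult: "d (x * y) = d x * y + x * d y"
begin

lemma zero: "d 0 = 0"
  using add[of 0 0] by simp

lemma one: "d 1 = 0"
  using mult[of 1 1] by simp

lemma uminus: "d (- x) = - d x"
  using add[of x "- x"] by (simp add: zero eq_neg_iff_add_eq_0 add.commute)

lemma diff: "d (x - y) = d x - d y"
  using add[of x "- y"] by (simp add: uminus)

lemma of_nat: "d (of_nat k) = 0"
  by (induction k) (simp_all add: zero one add)

lemma power: "d (x ^ k) = of_nat k * x ^ (k - 1) * d x"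
proof (induction k)
  case (Suc k)
  then show ?case
    by (cases k) (simp_all add: mult algebra_simps)
qed (simp add: one)

lemma adjoin:
  assumes "\<And>a. a \<in> R \<Longrightarrow> d a = 0" "\<And>a. a \<in> S \<Longrightarrow> d a = 0" "x \<in> adjoin R S"
  shows "d x = 0"
  using assms(3) by induction (simp_all add: assms one diff mult)

end

text \<open>Differentiate \<open>x * inverse x = 1\<close>; for \<open>x = 0\<close> the inverse is
  0.\<close>

lemma derivation_inverse:
  fixes d :: "'a::field \<Rightarrow> 'a"
  assumes "ring_derivation d" "d x = 0"
  shows "d (inverse x) = 0"
proof -
  interpret ring_derivation d by fact
  show ?thesis
    using mult[of x "inverse x"] assms(2) by (cases "x = 0") (auto simp: zero one)
qed

text \<open>Characteristic zero lets a vanishing \<open>pderiv\<close> force a constant polynomial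
  over the fraction field.\<close>

instance fract :: ("{idom, ring_char_0}") ring_char_0
proof
  have "of_nat k = to_fract (of_nat k :: 'a)" for k
    by (induction k) simp_all
  then show "inj (of_nat :: nat \<Rightarrow> 'a fract)"
    by (auto intro: injI)
qed

text \<open>The chain rule, for coefficients that are constants of \<open>d\<close>.\<close>

lemma derivation_poly:
  fixes d :: "'a::idom \<Rightarrow> 'a"
  assumes "ring_derivation d" "\<And>i. d (coeff p i) = 0"
  shows "d (poly p t) = poly (pderiv p) t * d t"
  using assms(2)
proof (induction p)
  case (pCons a p)
  interpret ring_derivation d by fact
  have "d a = 0" "\<And>i. d (coeff p i) = 0"
    using pCons.prems[of 0] pCons.prems[of "Suc _"] by simp_all
  then show ?case
    using pCons.IH by (simp add: add mult pderiv_pCons algebra_simps)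
qed (simp add: ring_derivation.zero[OF assms(1)])

text \<open>Differentiating \<open>poly p t = 0\<close> and cancelling \<open>d t\<close> gives a
  relation for \<open>pderiv p\<close>, of smaller degree unless \<open>p\<close> is constant. By
  induction \<open>pderiv p = 0\<close>, so \<open>p\<close> is constant and its value 0 is its only
  coefficient.\<close>

lemma derivation_poly_eq_0:
  fixes d :: "'a::{idom,ring_char_0} \<Rightarrow> 'a"
  assumes d: "ring_derivation d" and t: "d t \<noteq> 0"
    and "\<And>i. d (coeff p i) = 0" "poly p t = 0"
  shows "p = 0"
  using assms(3,4)
proof (induction "degree p" arbitrary: p rule: less_induct)
  case less
  interpret ring_derivation d by fact
  have "poly (pderiv p) t = 0"
    using derivation_poly[OF d, of p t] less.prems zero t by simp
  moreover have "d (coeff (pderiv p) i) = 0" for i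
    by (simp only: coeff_pderiv mult of_nat less.prems) simp
  ultimately have "degree p = 0 \<or> pderiv p = 0"
    using less.hyps[of "pderiv p"] by (cases "degree p") (auto simp: degree_pderiv)
  then obtain c where "p = [:c:]"
    by (auto simp: pderiv_eq_0_iff elim: degree_eq_zeroE)
  then show "p = 0"
    using less.prems by simp
qed

text \<open>Write \<open>x = poly p t\<close>. Then \<open>d x = 0\<close> makes \<open>t\<close> a
  root of \<open>pderiv p\<close>; as \<open>t\<close> is transcendental over the constants,
  \<open>pderiv p = 0\<close> and \<open>x\<close> is the constant coefficient of
  \<open>p\<close>.\<close>

lemma derivation_kernel_adjoin:
  fixes d :: "'a::{idom,ring_char_0} \<Rightarrow> 'a"
  assumes d: "ring_derivation d" and t: "d t \<noteq> 0"
    and ker: "\<And>a. a \<in> adjoin R S \<Longrightarrow> d a = 0"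
    and x: "x \<in> adjoin (adjoin R S) {t}" "d x = 0"
  shows "x \<in> adjoin R S"
proof -
  interpret ring_derivation d by fact
  obtain p where p: "\<And>i. coeff p i \<in> adjoin R S" "x = poly p t"
    using adjoin_singleton_poly[OF x(1)] by blast
  have "poly (pderiv p) t = 0"
    using derivation_poly[OF d, of p t] p ker x(2) t by simp
  moreover have "d (coeff (pderiv p) i) = 0" for i
    by (simp only: coeff_pderiv mult of_nat ker[OF p(1)]) simp
  ultimately have "pderiv p = 0"
    using derivation_poly_eq_0[OF d t] by blast
  then obtain c where "p = [:c:]"
    by (auto simp: pderiv_eq_0_iff elim: degree_eq_zeroE)
  then show ?thesis
    using p(1)[of 0] p(2) by simp
qed

section \<open>Extension of derivations to the fraction field\<close>

definition fract_der :: "('a::idom \<Rightarrow> 'a) \<Rightarrow> 'a fract \<Rightarrow> 'a fract"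
  where "fract_der d x =
    (let (a, b) = (SOME (a, b). b \<noteq> 0 \<and> x = Fract a b) in Fract (d a * b - a * d b) (b ^ 2))"

text \<open>The quotient rule does not depend on the chosen representative.\<close>

lemma fract_der_Fract:
  assumes "ring_derivation d" "b \<noteq> 0"
  shows "fract_der d (Fract a b) = Fract (d a * b - a * d b) (b ^ 2)"
proof -
  interpret ring_derivation d by fact
  define r where "r = (SOME (a', b'). b' \<noteq> 0 \<and> Fract a b = Fract a' b')"
  have "case r of (a', b') \<Rightarrow> b' \<noteq> 0 \<and> Fract a b = Fract a' b'"
    unfolding r_def by (rule someI_ex) (use assms(2) in auto)
  then obtain a' b' where r: "r = (a', b')" and b': "b' \<noteq> 0" and eq: "Fract a b = Fract a' b'"
    by (cases r) auto
  have ab: "a * b' = a' * b"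
    using eq assms(2) b' by (simp add: eq_fract)
  then have "d a * b' + a * d b' = d a' * b + a' * d b"
    using mult[of a b'] mult[of a' b] by simp
  \<comment> \<open>Multiply the differentiated relation by \<open>b * b'\<close> and eliminate the
    remaining terms with \<open>ab\<close>.\<close>
  with ab have "(d a * b - a * d b) * b' ^ 2 = (d a' * b' - a' * d b') * b ^ 2"
    by algebra
  then have "Fract (d a * b - a * d b) (b ^ 2) = Fract (d a' * b' - a' * d b') (b' ^ 2)"
    using assms(2) b' by (simp add: eq_fract)
  then show ?thesis
    by (simp add: fract_der_def r_def[symmetric] r)
qed

lemma fract_der_to_fract:
  assumes "ring_derivation d" shows "fract_der d (to_fract a) = to_fract (d a)"
proof -
  interpret ring_derivation d by fact
  show ?thesis
    using fract_der_Fract[OF assms, of 1 a] by (simp add: to_fract_def one)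
qed

lemma ring_derivation_fract_der:
  assumes "ring_derivation d" shows "ring_derivation (fract_der d)"
proof
  interpret ring_derivation d by fact
  note der = fract_der_Fract[OF assms]
  fix x y :: "'a fract"
  obtain a b where x: "x = Fract a b" "b \<noteq> 0" by (cases x) auto
  obtain a' b' where y: "y = Fract a' b'" "b' \<noteq> 0" by (cases y) auto
  show "fract_der d (x + y) = fract_der d x + fract_der d y"
    using x(2) y(2) unfolding x(1) y(1)
    by (simp add: der eq_fract add mult) (simp add: algebra_simps power2_eq_square)
  show "fract_der d (x * y) = fract_der d x * y + x * fract_der d y"
    using x(2) y(2) unfolding x(1) y(1)
    by (simp add: der eq_fract add mult) (simp add: algebra_simps power2_eq_square)
qed

text \<open>
  Extending to the fraction field needs a derivation of the whole ring, whereas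
  \<^const>\<open>derivation_on\<close> says nothing outside \<open>polys n\<close>.
\<close>

lemma kravchuk_total_extension:
  assumes D: "first_kravchuk_derivation n D"
  obtains G where "ring_derivation G" "first_kravchuk_derivation n G"
    "kernel_on n G = kernel_on n D" "\<And>m. m \<le> n \<Longrightarrow> cayley G m = cayley D m"
proof -
  define G where "G = ext_der n (\<lambda>i. D (qvar i))"
  have der: "derivation_on n D"
    using D by (simp add: first_kravchuk_derivation_def)
  then have DG: "derivation_on n G"
    unfolding G_def
    by (intro ext_der_derivation) (auto simp: derivation_on_def polys_qvar)
  have eq_qvar: "G (qvar i) = D (qvar i)" if "i \<le> n" for i
    using that by (simp add: G_def ext_der_qvar)
  have eq: "G f = D f" if "f \<in> polys n" for f
    using derivation_on_unique[OF DG der eq_qvar that] .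
  \<comment> \<open>Membership in \<open>polys n\<close> is carried along, since \<open>G\<close>
    and \<open>D\<close> are known to agree only there.\<close>
  have pow: "(G ^^ k) (qvar m) = (D ^^ k) (qvar m) \<and> (D ^^ k) (qvar m) \<in> polys n"
    if "m \<le> n" for m k
    by (induction k) (use that der in \<open>auto simp: polys_qvar eq derivation_on_def\<close>)
  show ?thesis
  proof
    show "ring_derivation G"
      by unfold_locales (simp_all add: G_def ext_der_add ext_der_mult)
    show "first_kravchuk_derivation n G"
      using D DG eq_qvar by (auto simp: first_kravchuk_derivation_def)
    show "kernel_on n G = kernel_on n D"
      using eq by (auto simp: kernel_on_def)
    show "cayley G m = cayley D m" if "m \<le> n" for m
      using pow[OF that] by (simp add: cayley_def sigma_def)
  qed
qed

section \<open>Rational constants and polynomials inside the fraction field\<close>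

lemma to_fract_sum: "to_fract (sum f I) = (\<Sum>i\<in>I. to_fract (f i))"
  by (induction I rule: infinite_finite_induct) simp_all

lemma of_nat_eq_to_fract_qconst: "of_nat k = to_fract (qconst (of_nat k))"
  by (induction k) (simp_all add: qconst_0 qconst_add qconst_1)

text \<open>Serves the factors \<open>1 / k!\<close> of \<open>sigma\<close> and the normalisation
  of the Cayley elements.\<close>

lemma inverse_of_nat_rationals: "inverse (of_nat k) \<in> rationals"
proof -
  have "inverse (of_nat k) = to_fract (qconst (inverse (of_nat k)))"
  proof (cases "k = 0")
    case False
    have "of_nat k * to_fract (qconst (inverse (of_nat k))) =
        to_fract (qconst (of_nat k * inverse (of_nat k)))"
      by (simp only: of_nat_eq_to_fract_qconst qconst_mult to_fract_mult)
    also have "\<dots> = 1"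
      using False by (simp add: qconst_1)
    finally show ?thesis
      by (rule inverse_unique)
  qed (simp add: qconst_0)
  then show ?thesis
    unfolding rationals_def by blast
qed

lemma single_eq_prod_qvar:
  "Poly_Mapping.single t c =
    qconst c * (\<Prod>i\<in>Poly_Mapping.keys t. qvar i ^ Poly_Mapping.lookup t i)"
proof -
  have "qvar i ^ k = Poly_Mapping.single (Poly_Mapping.single i k) 1" for i k
    by (induction k) (simp_all add: qvar_def mult_single flip: single_add)
  moreover have "(\<Prod>i\<in>A. Poly_Mapping.single (g i) (1::rat)) =
      Poly_Mapping.single (\<Sum>i\<in>A. g i) 1" for A :: "nat set" and g :: "nat \<Rightarrow> nat \<Rightarrow>\<^sub>0 nat"
    by (induction A rule: infinite_finite_induct) (simp_all add: mult_single)
  ultimately show ?thesis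
    using poly_mapping_sum_single[of t, symmetric] by (simp add: qconst_def mult_single)
qed

lemma to_fract_polys_in_adjoin:
  assumes rat: "rationals \<subseteq> adjoin R S" and var: "\<And>i. i \<le> n \<Longrightarrow> to_fract (qvar i) \<in> adjoin R S"
    and f: "f \<in> polys n"
  shows "to_fract f \<in> adjoin R S"
proof (induction f rule: qpoly_induct)
  case (add t c g)
  have t: "Poly_Mapping.keys t \<subseteq> {0..n}"
    using add(1) f by (simp add: polys_def)
  have "to_fract (\<Prod>i\<in>A. qvar i ^ Poly_Mapping.lookup t i) \<in> adjoin R S"
    if "A \<subseteq> {0..n}" for A
    using that by (induction A rule: infinite_finite_induct)
      (auto simp: to_fract_power intro!: adjoin.one adjoin.mult adjoin_power var)
  moreover have "to_fract (qconst c) \<in> adjoin R S"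
    using rat by (auto simp: rationals_def)
  ultimately have "to_fract (Poly_Mapping.single t c) \<in> adjoin R S"
    using t unfolding single_eq_prod_qvar to_fract_mult by (intro adjoin.mult) auto
  then show ?case
    using add(2) by (simp add: adjoin_add)
qed (simp add: adjoin_0)

section \<open>The derivation on \<open>lam\<close> and on the series \<open>sigma\<close>\<close>

lemma kravchuk_qvar_1:
  assumes "first_kravchuk_derivation n D" "n \<ge> 1"
  shows "D (qvar 1) = qvar 0"
  using assms by (auto simp: first_kravchuk_derivation_def qconst_1)

text \<open>Differentiate \<open>lam * x0 = - x1\<close>, using \<open>D x0 = 0\<close> and
  \<open>D x1 = x0\<close>.\<close>

lemma fract_der_lam:
  assumes "ring_derivation D" "first_kravchuk_derivation n D" "n \<ge> 1"
  shows "fract_der D lam = - 1"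
proof -
  interpret E: ring_derivation "fract_der D"
    using assms(1) by (rule ring_derivation_fract_der)
  have "lam * to_fract (qvar 0) = - to_fract (qvar 1)"
    by (simp add: lam_def qvar_neq_0)
  then have "fract_der D (lam * to_fract (qvar 0)) = - to_fract (qvar 0)"
    using kravchuk_qvar_1[OF assms(2,3)]
    by (simp only: E.uminus fract_der_to_fract[OF assms(1)])
  moreover have "D (qvar 0) = 0"
    using assms(2) by (simp add: first_kravchuk_derivation_def)
  ultimately have "(fract_der D lam + 1) * to_fract (qvar 0) = 0"
    by (simp add: E.mult fract_der_to_fract[OF assms(1)] algebra_simps)
  then show ?thesis
    by (simp add: qvar_neq_0 eq_neg_iff_add_eq_0)
qed

lemma fract_der_rationals:
  assumes D: "ring_derivation D" "derivation_on n D" and "c \<in> rationals"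
  shows "fract_der D c = 0"
proof -
  obtain q where q: "c = to_fract (qconst q)"
    using assms(3) by (auto simp: rationals_def)
  have "D (qconst q * 1) = qconst q * D 1"
    using D(2) polys_qconst[of 1 n] unfolding derivation_on_def qconst_1 by blast
  then show ?thesis
    using derivation_on_1[OF D(2)] by (simp add: q fract_der_to_fract[OF D(1)])
qed

text \<open>The partial sum up to \<open>j\<close> has as derivative the single term with
  \<open>(D ^^ Suc j) (qvar m)\<close>, which vanishes for \<open>j = m\<close>.\<close>

lemma fract_der_sigma:
  assumes D: "ring_derivation D" "first_kravchuk_derivation n D" and "n \<ge> 1" "m \<le> n"
  shows "fract_der D (sigma D m) = 0"
proof -
  interpret E: ring_derivation "fract_der D"
    using D(1) by (rule ring_derivation_fract_der)
  let ?y = "\<lambda>k. to_fract ((D ^^ k) (qvar m))"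
  let ?c = "\<lambda>k. inverse (of_nat (fact k)) :: qpoly fract"
  have y: "fract_der D (?y k) = ?y (Suc k)" for k
    by (simp add: fract_der_to_fract[OF D(1)])
  have c: "fract_der D (?c k) = 0" for k
    using E.of_nat by (rule derivation_inverse[OF ring_derivation_fract_der[OF D(1)]])
  have "fract_der D (\<Sum>k\<le>j. ?y k * lam ^ k * ?c k) = ?y (Suc j) * lam ^ j * ?c j" for j
  proof (induction j)
    case 0
    then show ?case
      by (simp add: fract_der_to_fract[OF D(1)] E.mult E.one E.zero)
  next
    case (Suc j)
    \<comment> \<open>Turns the factor \<open>Suc j\<close> from differentiating
      \<open>lam ^ Suc j\<close> into \<open>1 / j!\<close>, so that the new term cancels the
      remainder left by the previous sum.\<close>
    have c_Suc: "?c j = of_nat (Suc j) * ?c (Suc j)"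
      by (simp only: fact_Suc of_nat_mult of_nat_id inverse_mult_distrib) (simp del: of_nat_Suc)
    have "fract_der D (?y (Suc j) * lam ^ Suc j * ?c (Suc j)) =
        ?y (Suc (Suc j)) * lam ^ Suc j * ?c (Suc j) - ?y (Suc j) * lam ^ j * ?c j"
      unfolding E.mult E.power c y fract_der_lam[OF D \<open>n \<ge> 1\<close>] c_Suc
      by (simp add: algebra_simps del: of_nat_Suc)
    then show ?case
      using Suc.IH by (simp only: sum.atMost_Suc E.add) simp
  qed
  from this[of m] show ?thesis
    using kravchuk_funpow_qvar_eq_0[OF D(2) \<open>m \<le> n\<close>, of "Suc m"]
    by (simp add: sigma_eq_sum[OF D(2) \<open>m \<le> n\<close>] divide_inverse mult.assoc)
qed

lemma sigma_0:
  assumes "first_kravchuk_derivation n D"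
  shows "sigma D 0 = to_fract (qvar 0)"
  using sigma_eq_sum[OF assms, of 0] by simp

text \<open>Here the series is \<open>x1 + x0 * lam\<close>; this is why the Cayley elements start
  at index 2.\<close>

lemma sigma_1:
  assumes "first_kravchuk_derivation n D" "n \<ge> 1"
  shows "sigma D 1 = 0"
  using sigma_eq_sum[OF assms] kravchuk_qvar_1[OF assms] by (simp add: lam_def qvar_neq_0)

text \<open>Recovering \<open>sigma\<close> from a Cayley element divides by a power of
  \<open>x0\<close>, hence the adjoined inverse of \<open>x0\<close>.\<close>

lemma sigma_eq_cayley:
  assumes "m \<ge> 2"
  shows "sigma D m = inverse (of_nat (m * fact (m - 2))) *
    inverse (to_fract (qvar 0)) ^ (m - 1) * cayley D m"
proof -
  have "(of_nat (m * fact (m - 2)) :: qpoly fract) \<noteq> 0"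
    using assms by (simp del: of_nat_mult)
  then show ?thesis
    by (simp add: cayley_def qvar_neq_0 field_simps del: of_nat_mult)
qed

section \<open>The kernel as an intersection\<close>

context
  fixes n :: nat and D :: "qpoly \<Rightarrow> qpoly"
  assumes n: "n \<ge> 1" and D: "first_kravchuk_derivation n D"
begin

private abbreviation (input) A :: "qpoly fract set"
  where "A \<equiv> adjoin (adjoin rationals ({to_fract (qvar 0)} \<union> cayley D ` {2..n}))
    {inverse (to_fract (qvar 0))}"

private lemma generators_in_A:
  "c \<in> rationals \<Longrightarrow> c \<in> A" "to_fract (qvar 0) \<in> A" "inverse (to_fract (qvar 0)) \<in> A"
  "m \<in> {2..n} \<Longrightarrow> cayley D m \<in> A"
  by (blast intro: adjoin.base adjoin.gen)+

lemma sigma_in_adjoin: "m \<le> n \<Longrightarrow> sigma D m \<in> A"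
proof -
  assume "m \<le> n"
  consider "m = 0" | "m = 1" | "m \<ge> 2" by linarith
  then show ?thesis
  proof cases
    case 1
    then show ?thesis
      using sigma_0[OF D] generators_in_A by simp
  next
    case 2
    then show ?thesis
      using sigma_1[OF D n] adjoin_0 by simp
  next
    case 3
    then show ?thesis
      using \<open>m \<le> n\<close> unfolding sigma_eq_cayley[OF 3]
      by (intro adjoin.mult adjoin_power generators_in_A inverse_of_nat_rationals) auto
  qed
qed

text \<open>All iterates are treated at once because solving \<open>sigma D m\<close> for
  \<open>x_m\<close> involves the higher ones. Those with at least one \<open>D\<close> are rational
  combinations of iterates at smaller indices.\<close>

lemma funpow_qvar_in_adjoin_lam: "m \<le> n \<Longrightarrow> to_fract ((D ^^ k) (qvar m)) \<in> adjoin A {lam}"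
proof (induction m arbitrary: k rule: less_induct)
  case (less m)
  have rat: "c \<in> adjoin A {lam}" if "c \<in> rationals" for c
    using that by (intro adjoin.base generators_in_A)
  have pos: "to_fract ((D ^^ Suc k) (qvar m)) \<in> adjoin A {lam}" for k
  proof (cases "m = 0")
    case True
    then show ?thesis
      using kravchuk_funpow_qvar_eq_0[OF D, of 0 "Suc k"] by (simp add: adjoin_0)
  next
    case False
    have "to_fract (qconst c) \<in> adjoin A {lam}" for c
      by (rule rat) (simp add: rationals_def)
    moreover have "to_fract ((D ^^ k) (qvar (m - i))) \<in> adjoin A {lam}" if "i \<in> {1..m}" for i
      using that less.prems by (intro less.IH) auto
    moreover have "(D ^^ Suc k) (qvar m) =
        (\<Sum>i=1..m. qconst ((1 - (-1) ^ i) / (2 * of_nat i)) * (D ^^ k) (qvar (m - i)))"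
      using False less.prems by (intro kravchuk_funpow_Suc[OF D]) auto
    ultimately show ?thesis
      by (simp only: to_fract_sum to_fract_mult) (intro adjoin_sum adjoin.mult)
  qed
  show ?case
  proof (cases k)
    case 0
    let ?term = "\<lambda>k. to_fract ((D ^^ k) (qvar m)) * (lam ^ k / of_nat (fact k))"
    \<comment> \<open>The summand for \<open>k = 0\<close> is \<open>x_m\<close> itself; the others
      are covered by \<open>pos\<close>.\<close>
    have "sigma D m = ?term 0 + (\<Sum>k<m. ?term (Suc k))"
      using sigma_eq_sum[OF D less.prems] by (simp only: sum.atMost_shift)
    then have "to_fract (qvar m) = sigma D m - (\<Sum>k<m. ?term (Suc k))"
      by simp
    also have "\<dots> \<in> adjoin A {lam}"
      unfolding divide_inverse
      by (intro adjoin.diff adjoin_sum adjoin.mult pos adjoin_power adjoin.gen rat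
          inverse_of_nat_rationals singletonI adjoin.base[OF sigma_in_adjoin] less.prems)
    finally show ?thesis
      using 0 by simp
  next
    case (Suc j)
    then show ?thesis
      using pos by simp
  qed
qed

lemma kernel_on_total_kravchuk:
  assumes "ring_derivation D"
  shows "to_fract ` kernel_on n D = A \<inter> to_fract ` polys n"
proof -
  interpret E: ring_derivation "fract_der D"
    using assms by (rule ring_derivation_fract_der)
  note E_to_fract = fract_der_to_fract[OF assms]
  have x0: "fract_der D (to_fract (qvar 0)) = 0"
    using D by (simp add: E_to_fract first_kravchuk_derivation_def)
  have inv: "fract_der D (inverse (to_fract (qvar 0))) = 0"
    using x0 by (rule derivation_inverse[OF ring_derivation_fract_der[OF assms]])
  have cayley: "fract_der D (cayley D m) = 0" if "m \<in> {2..n}" for m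
    using that x0 fract_der_sigma[OF assms D n, of m]
    unfolding cayley_def E.mult E.power E.of_nat by simp
  have rat: "fract_der D c = 0" if "c \<in> rationals" for c
    using D that fract_der_rationals[OF assms] by (auto simp: first_kravchuk_derivation_def)
  \<comment> \<open>\<open>A\<close> is a twofold adjunction, so \<open>E.adjoin\<close> is applied
    once to each layer.\<close>
  have ker: "fract_der D a = 0" if "a \<in> A" for a
    using _ _ that
  proof (rule E.adjoin)
    show "fract_der D b = 0"
      if "b \<in> adjoin rationals ({to_fract (qvar 0)} \<union> cayley D ` {2..n})" for b
      using _ _ that by (rule E.adjoin) (use x0 cayley rat in auto)
  qed (use inv in auto)
  have "to_fract f \<in> A" if "f \<in> polys n" "D f = 0" for f
  proof (rule derivation_kernel_adjoin)
    show "ring_derivation (fract_der D)" ..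
    show "fract_der D lam \<noteq> 0"
      using fract_der_lam[OF assms D n] by simp
    show "to_fract f \<in> adjoin A {lam}"
    proof (rule to_fract_polys_in_adjoin[OF _ _ that(1)])
      show "rationals \<subseteq> adjoin A {lam}"
        using generators_in_A(1) by (blast intro: adjoin.base)
      show "to_fract (qvar i) \<in> adjoin A {lam}" if "i \<le> n" for i
        using funpow_qvar_in_adjoin_lam[OF that, of 0] by simp
    qed
    show "fract_der D (to_fract f) = 0"
      using that by (simp add: E_to_fract)
  qed (rule ker)
  moreover have "D f = 0" if "to_fract f \<in> A" for f
    using ker[OF that] by (simp add: E_to_fract)
  ultimately show ?thesis
    by (auto simp: kernel_on_def)
qed

end

theorem theorem2p3:
  fixes n :: nat and D :: "qpoly \<Rightarrow> qpoly"
  assumes "n \<ge> 2"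
    and "first_kravchuk_derivation n D"
  shows "to_fract ` kernel_on n D =
    adjoin (adjoin rationals ({to_fract (qvar 0)} \<union> cayley D ` {2..n}))
      {inverse (to_fract (qvar 0))}
    \<inter> to_fract ` polys n"
proof -
  \<comment> \<open>Both sides depend only on \<open>D\<close> restricted to \<open>polys n\<close>,
    so \<open>D\<close> may be replaced by a derivation of the whole ring.\<close>
  obtain G where G: "ring_derivation G" "first_kravchuk_derivation n G"
    "kernel_on n G = kernel_on n D" "\<And>m. m \<le> n \<Longrightarrow> cayley G m = cayley D m"
    using kravchuk_total_extension[OF assms(2)] by blast
  have "cayley G ` {2..n} = cayley D ` {2..n}"
    using G(4) by (intro image_cong) auto
  then show ?thesis
    using kernel_on_total_kravchuk[OF _ G(2,1)] assms(1) G(3) by simp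
qed

end
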